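(* Let $x_s\in\mathbb{X}$, $N\in\mathbb{N}$, $\mathbb{X}_f\subseteq\mathbb{X}$ and $0\le\Delta t_{\min}\le\Delta t_{\max}$. Then the solutions to the following three optimization problems are identical. (A) The optimal control problem $$\min_{t_f,\;u\in\mathscr{U}^N(x_s,t_f)} t_f\quad\text{s.t.}\quad N\Delta t_{\min}\le t_f\le N\Delta t_{\max}.$$ (B) The nonlinear program (global uniform grid) $$\min_{u_0,\dots,u_{N-1},\;x_0,\dots,x_N,\;\Delta t} N\Delta t$$ subject to $x_0=x_s$, $x_N\in\mathbb{X}_f$, $\Delta t_{\min}\le\Delta t\le\Delta t_{\max}$, and $x_k\in\mathbb{X}$, $u_k\in\mathbb{U}$, $x_{k+1}=\varphi(\Delta t,x_k,u_k)$ for $k=0,\dots,N-1$. (C) The nonlinear program (local uniform grid) $$\min_{u_0,\dots,u_{N-1},\;x_0,\dots,x_N,\;\Delta t_0,\dots,\Delta t_{N-1}}\ \sum_{k=0}^{N-1}\Delta t_k$$ subject to $x_0=x_s$, $x_N\in\mathbb{X}_f$, $\Delta t_{\min}\le\Delta t_0\le\Delta t_{\max}$, $\Delta t_k=\Delta t_{k+1}$ for $k=0,\dots,N-2$, and $x_k\in\mathbb{X}$, $u_k\in\mathbb{U}$, $x_{k+1}=\varphi(\Delta t_k,x_k,u_k)$ for $k=0,\dots,N-1$. Here solutions are identified via $t_f=N\Delta t$, $\Delta t_k=\Delta t$ for all $k$, $u(t)=u_k$ for $t\in[k\Delta t,(k+1)\Delta t)$, and $x_k=\varphi(k t_f/N,x_s,u)$;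 in particular the optimal values coincide.
   Context: System. Let $p,q\in\mathbb{N}$, let $f:\mathbb{R}^p\times\mathbb{R}^q\to\mathbb{R}^p$ be continuous and Lipschitz in its first argument, and let $\mathbb{X}\subseteq\mathbb{R}^p$ and $\mathbb{U}\subset\mathbb{R}^q$ be the state and control constraint sets. For an initial state $x_s$ and a locally integrable control $u$, $\varphi(t,x_s,u)=x_s+\int_0^t f(x(\tau),u(\tau))\,d\tau$ denotes the solution at time $t$ of the time-invariant system $\dot x=f(x,u)$, $x(0)=x_s$ (assumed to exist uniquely); for $v\in\mathbb{R}^q$, $\varphi(t,x_s,v)$ means the solution under the constant control $v$. Piecewise constant controls. For $N\in\mathbb{N}$, $t_f\ge 0$, let $\mathcal{U}^N(t_f)$ be the set of $u:[0,t_f]\to\mathbb{R}^q$ for which there are $u_0,\dots,u_{N-1}\in\mathbb{R}^q$ with $u(t)=u_k$ for $t\in[t_k,t_{k+1})$, $t_k=k\,t_f/N$, $k=0,\dots,N-1$. Admissible controls. $\mathscr{U}^N(x_s,t_f)$ is the set of $u\in\mathcal{U}^N(t_f)$ such that $u(t)\in\mathbb{U}$ for all $t\in[0,t_f]$, $\varphi(k t_f/N,x_s,u)\in\mathbb{X}$ for $k=0,\dots,N-1$, and $\varphi(t_f,x_s,u)\in\mathbb{X}_f$. *)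

theory Defs
  imports "HOL-Analysis.Analysis"
begin

(* Caratheodory solution on {0..T}. Trajectories are made unique as HOL functions by
   extensionality; by absolute integrability, integral is the Lebesgue integral. *)
definition solves ::
    "('a::euclidean_space \<times> 'b \<Rightarrow> 'a) \<Rightarrow> real \<Rightarrow> 'a \<Rightarrow> (real \<Rightarrow> 'b) \<Rightarrow> (real \<Rightarrow> 'a) \<Rightarrow> bool" where
  "solves f T x0 u x \<longleftrightarrow>
     x \<in> extensional {0..T} \<and>
     (\<lambda>\<tau>. f (x \<tau>, u \<tau>)) absolutely_integrable_on {0..T} \<and>
     (\<forall>t\<in>{0..T}. x t = x0 + integral {0..t} (\<lambda>\<tau>. f (x \<tau>, u \<tau>)))"

(* Only the values of u on {0..t} matter. The constant control v is the function (\<lambda>_. v). *)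
definition flow ::
    "('a::euclidean_space \<times> 'b \<Rightarrow> 'a) \<Rightarrow> real \<Rightarrow> 'a \<Rightarrow> (real \<Rightarrow> 'b) \<Rightarrow> 'a" where
  "flow f t x0 u = (THE x. solves f t x0 u x) t"

(* The intervals are half-open, so the value at the final time T is unconstrained. *)
definition pc_controls :: "nat \<Rightarrow> real \<Rightarrow> (real \<Rightarrow> 'b) set" where
  "pc_controls N T =
     {u \<in> extensional {0..T}.
        \<exists>v. length v = N \<and>
          (\<forall>k<N. \<forall>t\<in>{real k * T / real N..<real (Suc k) * T / real N}. u t = v ! k)}"

definition admissible_controls ::
    "('a::euclidean_space \<times> 'b \<Rightarrow> 'a) \<Rightarrow> 'a set \<Rightarrow> 'b set \<Rightarrow> 'a set \<Rightarrow> nat \<Rightarrow> 'a \<Rightarrow> real \<Rightarrow>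
       (real \<Rightarrow> 'b) set" where
  "admissible_controls f X U Xf N x_s tf =
     {u \<in> pc_controls N tf.
        (\<forall>t\<in>{0..tf}. u t \<in> U) \<and>
        (\<forall>k<N. flow f (real k * tf / real N) x_s u \<in> X) \<and>
        flow f tf x_s u \<in> Xf}"

definition minimizers :: "('z \<Rightarrow> real) \<Rightarrow> 'z set \<Rightarrow> 'z set" where
  "minimizers J F = {z. is_arg_min J (\<lambda>w. w \<in> F) z}"

(* The value is \<infinity> for an infeasible problem. *)
definition optimal_value :: "('z \<Rightarrow> real) \<Rightarrow> 'z set \<Rightarrow> ereal" where
  "optimal_value J F = (INF z\<in>F. ereal (J z))"

definition ocp_feasible ::
    "('a::euclidean_space \<times> 'b \<Rightarrow> 'a) \<Rightarrow> 'a set \<Rightarrow> 'b set \<Rightarrow> 'a set \<Rightarrow> nat \<Rightarrow> 'a \<Rightarrow> real \<Rightarrow> real \<Rightarrow>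
       (real \<times> (real \<Rightarrow> 'b)) set" where
  "ocp_feasible f X U Xf N x_s dmin dmax =
     {(tf, u). real N * dmin \<le> tf \<and> tf \<le> real N * dmax \<and>
        u \<in> admissible_controls f X U Xf N x_s tf}"

definition ocp_cost :: "real \<times> (real \<Rightarrow> 'b) \<Rightarrow> real" where
  "ocp_cost = (\<lambda>(tf, u). tf)"

definition global_feasible ::
    "('a::euclidean_space \<times> 'b \<Rightarrow> 'a) \<Rightarrow> 'a set \<Rightarrow> 'b set \<Rightarrow> 'a set \<Rightarrow> nat \<Rightarrow> 'a \<Rightarrow> real \<Rightarrow> real \<Rightarrow>
       ('b list \<times> 'a list \<times> real) set" where
  "global_feasible f X U Xf N x_s dmin dmax =
     {(us, xs, dt). length us = N \<and> length xs = Suc N \<and>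
        xs ! 0 = x_s \<and> xs ! N \<in> Xf \<and> dmin \<le> dt \<and> dt \<le> dmax \<and>
        (\<forall>k<N. xs ! k \<in> X \<and> us ! k \<in> U \<and>
           xs ! Suc k = flow f dt (xs ! k) (\<lambda>_. us ! k))}"

definition global_cost :: "nat \<Rightarrow> 'b list \<times> 'a list \<times> real \<Rightarrow> real" where
  "global_cost N = (\<lambda>(us, xs, dt). real N * dt)"

definition local_feasible ::
    "('a::euclidean_space \<times> 'b \<Rightarrow> 'a) \<Rightarrow> 'a set \<Rightarrow> 'b set \<Rightarrow> 'a set \<Rightarrow> nat \<Rightarrow> 'a \<Rightarrow> real \<Rightarrow> real \<Rightarrow>
       ('b list \<times> 'a list \<times> real list) set" where
  "local_feasible f X U Xf N x_s dmin dmax =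
     {(us, xs, dts). length us = N \<and> length xs = Suc N \<and> length dts = N \<and>
        xs ! 0 = x_s \<and> xs ! N \<in> Xf \<and> dmin \<le> dts ! 0 \<and> dts ! 0 \<le> dmax \<and>
        (\<forall>k. Suc k < N \<longrightarrow> dts ! k = dts ! Suc k) \<and>
        (\<forall>k<N. xs ! k \<in> X \<and> us ! k \<in> U \<and>
           xs ! Suc k = flow f (dts ! k) (xs ! k) (\<lambda>_. us ! k))}"

definition local_cost :: "nat \<Rightarrow> 'b list \<times> 'a list \<times> real list \<Rightarrow> real" where
  "local_cost N = (\<lambda>(us, xs, dts). \<Sum>k<N. dts ! k)"

(* This is a relation rather than a function: the value of u at tf is not matched with
   any us ! k, and for dt = 0 all the half-open intervals are empty. *)
definition identified ::
    "('a::euclidean_space \<times> 'b \<Rightarrow> 'a) \<Rightarrow> nat \<Rightarrow> 'a \<Rightarrow>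
       real \<times> (real \<Rightarrow> 'b) \<Rightarrow> 'b list \<times> 'a list \<times> real \<Rightarrow> 'b list \<times> 'a list \<times> real list \<Rightarrow> bool" where
  "identified f N x_s = (\<lambda>(tf, u) (us, xs, dt) (us', xs', dts).
     us' = us \<and> xs' = xs \<and>
     tf = real N * dt \<and> (\<forall>k<N. dts ! k = dt) \<and>
     (\<forall>k<N. \<forall>t\<in>{real k * dt..<real (Suc k) * dt}. u t = us ! k) \<and>
     (\<forall>k\<le>N. xs ! k = flow f (real k * tf / real N) x_s u))"

end

theory Submission
  imports Defs
begin

text \<open>
  Values of the control on a null set do not affect the integral equation, so the solution under a
  piecewise constant control restarts at every grid point as the solution under the constant
  control of the next interval. Hence a feasible point of any one of the three problems produces,
  by sampling the trajectory or by gluing the constant controls, identified feasible points of the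
  other two with the same cost, and both minimizers and optimal values transfer.
\<close>

section \<open>Solutions of the integral equation: change on a null set, restriction, time
  shift\<close>

text \<open>The two integrands differ at most at the single point \<open>T\<close>, a null set.
  Leaving \<open>T\<close> free matches the half-open intervals of piecewise constant controls,
  which say nothing about the right end of an interval.\<close>

lemma solves_cong_imp:
  assumes "solves f T x0 u x" and "\<And>t. t \<in> {0..<T} \<Longrightarrow> w t = u t"
  shows "solves f T x0 w x"
proof -
  have eq: "f (x t, w t) = f (x t, u t)" if "t \<in> {0..T} - {T}" for t
    using assms(2) that by auto
  have "(\<lambda>\<tau>. f (x \<tau>, u \<tau>)) absolutely_integrable_on {0..T}"
    using assms(1) by (simp add: solves_def)
  then have "(\<lambda>\<tau>. f (x \<tau>, w \<tau>)) absolutely_integrable_on {0..T}"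
    by (rule absolutely_integrable_spike[where S = "{T}"]) (use eq in auto)
  moreover have "integral {0..t} (\<lambda>\<tau>. f (x \<tau>, w \<tau>)) = integral {0..t} (\<lambda>\<tau>. f (x \<tau>, u \<tau>))"
    if "t \<in> {0..T}" for t
    by (rule integral_spike[where S = "{T}"]) (use that eq in auto)
  ultimately show ?thesis
    using assms(1) by (simp add: solves_def)
qed

lemma solves_cong:
  assumes "\<And>t. t \<in> {0..<T} \<Longrightarrow> u t = w t"
  shows "solves f T x0 u = solves f T x0 w"
  using solves_cong_imp[of f T x0 u _ w] solves_cong_imp[of f T x0 w _ u] assms by (intro ext) auto

lemma flow_eqI:
  assumes "\<exists>!x. solves f T x0 u x" and "solves f T x0 u x"
  shows "flow f T x0 u = x T"
  using theI'[OF assms(1)] assms by (auto simp: flow_def)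

text \<open>Solutions are extensional on their own interval, so the shorter one has to be cut down
  by \<open>restrict\<close>; the integrand on \<open>{0..a}\<close> stays the same.\<close>

lemma solves_initial_segment:
  assumes "solves f T x0 u x" and "a \<le> T"
  shows "solves f a x0 u (restrict x {0..a})"
proof -
  have "(\<lambda>\<tau>. f (x \<tau>, u \<tau>)) absolutely_integrable_on {0..a}"
    using assms by (auto simp: solves_def intro: absolutely_integrable_on_subinterval)
  then have "(\<lambda>\<tau>. f (restrict x {0..a} \<tau>, u \<tau>)) absolutely_integrable_on {0..a}"
    \<comment> \<open>With an empty exceptional set the spike rule acts as a congruence rule for
      absolute integrability.\<close>
    by (rule absolutely_integrable_spike[where S = "{}"]) auto
  moreover have "integral {0..t} (\<lambda>\<tau>. f (restrict x {0..a} \<tau>, u \<tau>)) =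
      integral {0..t} (\<lambda>\<tau>. f (x \<tau>, u \<tau>))" if "t \<in> {0..a}" for t
    by (rule integral_cong) (use that in auto)
  ultimately show ?thesis
    using assms by (simp add: solves_def)
qed

text \<open>The integral over \<open>{0..a + t}\<close> splits at \<open>a\<close>. Since
  \<open>f\<close> does not depend on time, translating the second part by \<open>a\<close> turns it
  into the integral equation started at \<open>x a\<close>.\<close>

lemma solves_shift:
  assumes sol: "solves f (a + b) x0 u x" and "0 \<le> a" "0 \<le> b"
  shows "solves f b (x a) (\<lambda>t. u (a + t)) (restrict (\<lambda>t. x (a + t)) {0..b})"
proof -
  let ?g = "\<lambda>\<tau>. f (x \<tau>, u \<tau>)"
  let ?h = "\<lambda>\<tau>. f (restrict (\<lambda>t. x (a + t)) {0..b} \<tau>, u (a + \<tau>))"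
  have int: "?g absolutely_integrable_on {0..a + b}"
    using sol by (simp add: solves_def)
  have "?g absolutely_integrable_on {a..b + a}"
    using int by (rule absolutely_integrable_on_subinterval) (use assms in auto)
  \<comment> \<open>Absolute integrability is integrability of the function and of its norm; each is
    translated separately.\<close>
  then have "(?g \<circ> (+) a) absolutely_integrable_on {0..b}"
    using integrable_on_shift_Icc_real[of ?g a 0 b]
      integrable_on_shift_Icc_real[of "\<lambda>t. norm (?g t)" a 0 b]
    by (simp add: absolutely_integrable_on_def o_def)
  then have "?h absolutely_integrable_on {0..b}"
    by (rule absolutely_integrable_spike[where S = "{}"]) auto
  moreover have "x (a + t) = x a + integral {0..t} ?h" if t: "t \<in> {0..b}" for t
  proof -
    have "integral {0..t} ?h = integral {0..t} (?g \<circ> (+) a)"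
      by (rule integral_cong) (use t in auto)
    also have "\<dots> = integral {a..a + t} ?g"
      by (subst integral_shift_Icc_real) (simp add: add.commute)
    finally have h: "integral {0..t} ?h = integral {a..a + t} ?g" .
    have "?g integrable_on {0..a + t}"
      using absolutely_integrable_on_subinterval[OF int, of 0 "a + t"] t
      by (auto intro: set_lebesgue_integral_eq_integral(1))
    then have "integral {0..a} ?g + integral {a..a + t} ?g = integral {0..a + t} ?g"
      by (intro Henstock_Kurzweil_Integration.integral_combine) (use assms t in auto)
    moreover have "x (a + t) = x0 + integral {0..a + t} ?g" "x a = x0 + integral {0..a} ?g"
      using sol t assms by (auto simp: solves_def)
    ultimately show ?thesis
      unfolding h by (simp add: add.assoc)
  qed
  ultimately show ?thesis
    using assms by (simp add: solves_def)
qed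

text \<open>Semigroup property. By uniqueness all three flows are values of one trajectory
  \<open>x\<close>: its initial segment on \<open>{0..a}\<close> and its tail shifted to 0. The
  control \<open>w\<close> need only agree with the shifted \<open>u\<close> before time
  \<open>b\<close>, so it may be constant even if \<open>u\<close> jumps at
  \<open>a + b\<close>.\<close>

lemma flow_add:
  assumes ab: "0 \<le> a" "0 \<le> b"
    and sol_ab: "\<exists>!x. solves f (a + b) x0 u x" and sol_a: "\<exists>!x. solves f a x0 u x"
    and sol_b: "\<And>y. \<exists>!x. solves f b y w x"
    and w: "\<And>t. t \<in> {0..<b} \<Longrightarrow> w t = u (a + t)"
  shows "flow f (a + b) x0 u = flow f b (flow f a x0 u) w"
proof -
  obtain x where x: "solves f (a + b) x0 u x"
    using sol_ab by blast
  have "flow f a x0 u = x a"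
    using flow_eqI[OF sol_a solves_initial_segment[OF x]] ab by simp
  moreover have "solves f b (x a) w (restrict (\<lambda>t. x (a + t)) {0..b})"
    using solves_shift[OF x ab] w by (rule solves_cong_imp)
  then have "flow f b (x a) w = x (a + b)"
    using flow_eqI[OF sol_b] ab by fastforce
  ultimately show ?thesis
    using flow_eqI[OF sol_ab x] by simp
qed

text \<open>Used to evaluate the glued control on a grid interval. That the interval contains
  \<open>t\<close> already forces \<open>0 < d\<close>, so the division is genuine.\<close>

lemma floor_divide_eq_index:
  fixes d t :: real
  assumes "t \<in> {real k * d..<real (Suc k) * d}"
  shows "nat \<lfloor>t / d\<rfloor> = k"
proof -
  have "0 < d"
    using assms by (auto simp: algebra_simps)
  then have "\<lfloor>t / d\<rfloor> = int k"
    using assms by (intro floor_unique) (auto simp: field_simps)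
  then show ?thesis by simp
qed

section \<open>Transfer of minimizers and optimal values\<close>

text \<open>A cheaper point of \<open>G\<close> would have a counterpart in \<open>F\<close> of the
  same cost, contradicting the minimality of \<open>z\<close>.\<close>

lemma minimizers_transfer:
  assumes "z \<in> minimizers J F" and "w \<in> G" and "K w = J z"
    and "\<And>w'. w' \<in> G \<Longrightarrow> \<exists>z'\<in>F. J z' = K w'"
  shows "w \<in> minimizers K G"
  using assms unfolding minimizers_def is_arg_min_linorder mem_Collect_eq by metis

text \<open>Both problems attain the same set of costs, so the infima agree, also when both problems
  are infeasible.\<close>

lemma optimal_value_eqI:
  assumes "\<And>z. z \<in> F \<Longrightarrow> \<exists>w\<in>G. K w = J z" and "\<And>w. w \<in> G \<Longrightarrow> \<exists>z\<in>F. J z = K w"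
  shows "optimal_value J F = optimal_value K G"
proof -
  have "(\<lambda>z. ereal (J z)) ` F = (\<lambda>w. ereal (K w)) ` G"
    using assms by (force simp: image_iff)
  then show ?thesis
    by (simp add: optimal_value_def)
qed

text \<open>The optimization part, free of dynamics: if \<open>R\<close> preserves costs and reaches
  every feasible point of each problem, then partners of a minimizer are minimizers. No minimizer is
  claimed to exist.\<close>

lemma solution_correspondence:
  assumes abc: "\<And>a b c. R a b c \<Longrightarrow> a \<in> F \<and> b \<in> G \<and> c \<in> H \<and> K b = J a \<and> L c = J a"
    and a: "\<And>a. a \<in> F \<Longrightarrow> \<exists>b c. R a b c"
    and b: "\<And>b. b \<in> G \<Longrightarrow> \<exists>a c. R a b c"
    and c: "\<And>c. c \<in> H \<Longrightarrow> \<exists>a b. R a b c"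
  shows "(\<forall>a\<in>minimizers J F. \<exists>b\<in>minimizers K G. \<exists>c\<in>minimizers L H. R a b c) \<and>
    (\<forall>b\<in>minimizers K G. \<exists>a\<in>minimizers J F. \<exists>c\<in>minimizers L H. R a b c) \<and>
    (\<forall>c\<in>minimizers L H. \<exists>a\<in>minimizers J F. \<exists>b\<in>minimizers K G. R a b c) \<and>
    optimal_value J F = optimal_value K G \<and> optimal_value K G = optimal_value L H"
proof -
  have FG: "\<exists>w\<in>G. K w = J z" and FH: "\<exists>w\<in>H. L w = J z" if "z \<in> F" for z
    using a[OF that] abc by metis+
  have GF: "\<exists>w\<in>F. J w = K z" and GH: "\<exists>w\<in>H. L w = K z" if "z \<in> G" for z
    using b[OF that] abc by metis+
  have HF: "\<exists>w\<in>F. J w = L z" and HG: "\<exists>w\<in>G. K w = L z" if "z \<in> H" for z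
    using c[OF that] abc by metis+
  have "\<exists>b\<in>minimizers K G. \<exists>c\<in>minimizers L H. R z b c" if z: "z \<in> minimizers J F" for z
  proof -
    have "z \<in> F"
      using z by (simp add: minimizers_def is_arg_min_def)
    then obtain b c where R: "R z b c"
      using a by blast
    show ?thesis
      using abc[OF R] R minimizers_transfer[OF z, of b G K] minimizers_transfer[OF z, of c H L] GF HF
      by metis
  qed
  moreover have "\<exists>a\<in>minimizers J F. \<exists>c\<in>minimizers L H. R a z c" if z: "z \<in> minimizers K G" for z
  proof -
    have "z \<in> G"
      using z by (simp add: minimizers_def is_arg_min_def)
    then obtain a c where R: "R a z c"
      using b by blast
    show ?thesis
      using abc[OF R] R minimizers_transfer[OF z, of a F J] minimizers_transfer[OF z, of c H L] FG HG
      by metis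
  qed
  moreover have "\<exists>a\<in>minimizers J F. \<exists>b\<in>minimizers K G. R a b z" if z: "z \<in> minimizers L H" for z
  proof -
    have "z \<in> H"
      using z by (simp add: minimizers_def is_arg_min_def)
    then obtain a b where R: "R a b z"
      using c by blast
    show ?thesis
      using abc[OF R] R minimizers_transfer[OF z, of a F J] minimizers_transfer[OF z, of b G K] FH GH
      by metis
  qed
  moreover have "optimal_value J F = optimal_value K G"
    using FG GF by (intro optimal_value_eqI)
  moreover have "optimal_value K G = optimal_value L H"
    using GH HG by (intro optimal_value_eqI)
  ultimately show ?thesis
    by blast
qed

section \<open>Local versus global uniform grid\<close>

text \<open>The constraints equate neighbouring steps, so induction leads every step back to the
  first. Points of the local problem thereby take the form covered by the next lemma.\<close>

lemma local_dts_eq_replicate: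
  assumes "(us, xs, dts) \<in> local_feasible f X U Xf N x_s dmin dmax"
  shows "dts = replicate N (dts ! 0)"
proof -
  have "dts ! k = dts ! 0" if "k < N" for k
    using that assms by (induction k) (auto simp: local_feasible_def)
  moreover have "length dts = N"
    using assms by (simp add: local_feasible_def)
  ultimately show ?thesis
    by (intro nth_equalityI) (simp, metis nth_replicate)
qed

lemma replicate_in_local_feasible_iff:
  assumes "0 < N"
  shows "(us, xs, replicate N dt) \<in> local_feasible f X U Xf N x_s dmin dmax \<longleftrightarrow>
    (us, xs, dt) \<in> global_feasible f X U Xf N x_s dmin dmax"
  using assms by (simp add: local_feasible_def global_feasible_def)

section \<open>Flow under piecewise constant controls\<close>

text \<open>Unique solvability ranges over all \<open>M\<close> and \<open>T\<close> because the
  restart argument uses it on every initial part of the grid and on single intervals with constant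
  control.\<close>

locale well_posed_system =
  fixes f :: "'a::euclidean_space \<times> 'b \<Rightarrow> 'a"
  assumes unique: "\<And>M T x0 u. 0 < M \<Longrightarrow> 0 \<le> T \<Longrightarrow> u \<in> pc_controls M T \<Longrightarrow> \<exists>!x. solves f T x0 u x"
begin

text \<open>Well-posedness for the first \<open>M\<close> grid intervals of a control that may be
  defined beyond them: restricting it gives a member of \<open>pc_controls\<close> without changing
  its solutions.\<close>

lemma ex1_solves_grid:
  assumes "0 \<le> d" and "\<And>k t. k < M \<Longrightarrow> t \<in> {real k * d..<real (Suc k) * d} \<Longrightarrow> u t = v ! k"
    and "M \<le> length v"
  shows "\<exists>!x. solves f (real M * d) x0 u x"
proof -
  let ?T = "real M * d"
  let ?u = "restrict u {0..?T}"
  have "\<exists>!x. solves f ?T x0 ?u x"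
  proof (cases "M = 0")
    case True
    \<comment> \<open>\<open>unique\<close> asks for at least one piece. On a horizon of length 0
      the one interval is empty, so any value serves as its witness.\<close>
    have "restrict u {0..0} \<in> pc_controls 1 0"
      by (auto simp: pc_controls_def intro: exI[of _ "[undefined]"])
    then show ?thesis
      using unique[of 1 0 "restrict u {0..0}"] True by simp
  next
    case False
    have "?u t = take M v ! k" if k: "k < M" and t: "t \<in> {real k * d..<real (Suc k) * d}" for k t
    proof -
      have "0 \<le> real k * d" "real (Suc k) * d \<le> ?T"
        using k assms(1) by (auto intro!: mult_right_mono)
      then have "t \<in> {0..?T}"
        using t by auto
      then show ?thesis
        using assms(2)[OF k t] k by simp
    qed
    then have "?u \<in> pc_controls M ?T"
      using False assms(3) by (auto simp: pc_controls_def intro!: exI[of _ "take M v"])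
    then show ?thesis
      using unique[of M ?T ?u] False assms(1) by simp
  qed
  moreover have "solves f ?T x0 ?u = solves f ?T x0 u"
    by (rule solves_cong) auto
  ultimately show ?thesis
    by simp
qed

lemma ex1_solves_const:
  assumes "0 \<le> d"
  shows "\<exists>!x. solves f d x0 (\<lambda>_. v) x"
  using ex1_solves_grid[of d 1 "\<lambda>_. v" "[v]" x0] assms by simp

lemma flow_0: "flow f 0 x0 u = x0"
proof -
  have ex1: "\<exists>!x. solves f 0 x0 u x"
    using ex1_solves_grid[of 0 0 u "[]" x0] by simp
  then obtain x where "solves f 0 x0 u x"
    by blast
  then show ?thesis
    using flow_eqI[OF ex1] by (simp add: solves_def)
qed

text \<open>\<open>flow_add\<close> with \<open>a = real k * d\<close> and \<open>b = d\<close>: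
  after the shift, \<open>u\<close> equals \<open>v ! k\<close> on \<open>{0..<d}\<close>. This is
  the recursion by which the nonlinear programs constrain their states.\<close>

lemma flow_grid_Suc:
  assumes d: "0 \<le> d" and u: "\<And>k t. k < N \<Longrightarrow> t \<in> {real k * d..<real (Suc k) * d} \<Longrightarrow> u t = v ! k"
    and N: "N \<le> length v" and k: "k < N"
  shows "flow f (real (Suc k) * d) x0 u = flow f d (flow f (real k * d) x0 u) (\<lambda>_. v ! k)"
proof -
  have "\<exists>!x. solves f (real j * d) x0 u x" if "j \<le> N" for j
    by (rule ex1_solves_grid[where v = v]) (use d u N that in auto)
  from this[of "Suc k"] this[of k]
  have "\<exists>!x. solves f (real k * d + d) x0 u x" "\<exists>!x. solves f (real k * d) x0 u x"
    using k by (simp_all add: algebra_simps)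
  then have "flow f (real k * d + d) x0 u = flow f d (flow f (real k * d) x0 u) (\<lambda>_. v ! k)"
    using d k u[OF k] by (intro flow_add ex1_solves_const) (auto simp: algebra_simps)
  then show ?thesis
    by (simp add: algebra_simps)
qed

section \<open>Sampling and gluing\<close>

lemma ocp_to_global:
  assumes feas: "(tf, u) \<in> ocp_feasible f X U Xf N x_s dmin dmax" and N: "0 < N" and "0 \<le> dmin"
  shows "\<exists>us xs dt. (us, xs, dt) \<in> global_feasible f X U Xf N x_s dmin dmax \<and>
    identified f N x_s (tf, u) (us, xs, dt) (us, xs, replicate N dt)"
proof -
  define d where "d = tf / real N"
  have tf: "tf = real N * d"
    using N by (simp add: d_def)
  have d: "dmin \<le> d" "d \<le> dmax" "0 \<le> d"
    using feas N \<open>0 \<le> dmin\<close> by (auto simp: ocp_feasible_def tf)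
  \<comment> \<open>The values are sampled at left ends of intervals, not taken from the witness of
    \<open>pc_controls\<close>: for \<open>d = 0\<close> the intervals are empty and that witness
    need not lie in \<open>U\<close>, whereas \<open>u 0\<close> does.\<close>
  define us where "us = map (\<lambda>k. u (real k * d)) [0..<N]"
  define xs where "xs = map (\<lambda>k. flow f (real k * d) x_s u) [0..<Suc N]"
  have u: "u \<in> admissible_controls f X U Xf N x_s tf"
    using feas by (simp add: ocp_feasible_def)
  then obtain v where v: "\<And>k t. k < N \<Longrightarrow> t \<in> {real k * d..<real (Suc k) * d} \<Longrightarrow> u t = v ! k"
    using N by (auto simp: admissible_controls_def pc_controls_def tf)
  have us: "u t = us ! k" if k: "k < N" and t: "t \<in> {real k * d..<real (Suc k) * d}" for k t
  proof -
    have "real k * d \<in> {real k * d..<real (Suc k) * d}"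
      using t by auto
    then show ?thesis
      using v[OF k t] v[OF k] k by (simp add: us_def)
  qed
  have "us ! k \<in> U" if "k < N" for k
  proof -
    have "real k * d \<in> {0..tf}"
      using that d by (auto simp: tf intro!: mult_right_mono)
    then show ?thesis
      using u that by (auto simp: admissible_controls_def us_def)
  qed
  moreover have xs: "xs ! k = flow f (real k * d) x_s u" if "k \<le> N" for k
    using that unfolding xs_def by (subst nth_map) (auto simp del: upt_Suc)
  moreover have "xs ! Suc k = flow f d (xs ! k) (\<lambda>_. us ! k)" if "k < N" for k
  proof -
    have "flow f (real (Suc k) * d) x_s u = flow f d (flow f (real k * d) x_s u) (\<lambda>_. us ! k)"
      by (rule flow_grid_Suc[OF d(3) us]) (use that in \<open>auto simp: us_def\<close>)
    then show ?thesis
      using that by (simp only: xs Suc_leI less_imp_le)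
  qed
  moreover have "flow f (real k * d) x_s u \<in> X" if "k < N" for k
    using u that N by (auto simp: admissible_controls_def tf)
  moreover have "flow f (real N * d) x_s u \<in> Xf"
    using u by (simp add: admissible_controls_def tf)
  moreover have "length us = N" "length xs = Suc N"
    by (simp_all add: us_def xs_def)
  ultimately have "(us, xs, d) \<in> global_feasible f X U Xf N x_s dmin dmax"
    using d by (simp add: global_feasible_def flow_0)
  moreover have "identified f N x_s (tf, u) (us, xs, d) (us, xs, replicate N d)"
    using us xs N by (simp add: identified_def tf)
  ultimately show ?thesis
    by blast
qed

text \<open>The constant controls are glued along the grid; the resulting trajectory passes through
  the prescribed states, so the state and terminal constraints carry over.\<close>

lemma global_to_ocp:
  assumes feas: "(us, xs, d) \<in> global_feasible f X U Xf N x_s dmin dmax" and N: "0 < N"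
    and "0 \<le> dmin"
  shows "\<exists>tf u. (tf, u) \<in> ocp_feasible f X U Xf N x_s dmin dmax \<and>
    identified f N x_s (tf, u) (us, xs, d) (us, xs, replicate N d)"
proof -
  define tf where "tf = real N * d"
  (* The minimum extends the last control value to the final time; for d = 0 division by zero
     selects us ! 0. *)
  define u where "u = restrict (\<lambda>t. us ! min (N - 1) (nat \<lfloor>t / d\<rfloor>)) {0..tf}"
  have d: "dmin \<le> d" "d \<le> dmax" "0 \<le> d"
    using feas \<open>0 \<le> dmin\<close> by (auto simp: global_feasible_def)
  have us: "u t = us ! k" if k: "k < N" and t: "t \<in> {real k * d..<real (Suc k) * d}" for k t
  proof -
    have "0 \<le> real k * d" "real (Suc k) * d \<le> tf"
      using k d by (auto simp: tf_def intro!: mult_right_mono)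
    then have "t \<in> {0..tf}"
      using t by auto
    moreover have "min (N - 1) k = k"
      using k by simp
    ultimately show ?thesis
      by (simp only: u_def restrict_apply floor_divide_eq_index[OF t] if_True)
  qed
  have len: "length us = N"
    using feas by (simp add: global_feasible_def)
  \<comment> \<open>Both sequences start at \<open>x_s\<close> and obey the same one-step
    recursion.\<close>
  have xs: "xs ! k = flow f (real k * d) x_s u" if "k \<le> N" for k
    using that
  proof (induction k)
    case 0
    then show ?case
      using feas by (simp add: global_feasible_def flow_0)
  next
    case (Suc k)
    then have "xs ! Suc k = flow f d (flow f (real k * d) x_s u) (\<lambda>_. us ! k)"
      using feas by (simp add: global_feasible_def)
    then show ?case
      using flow_grid_Suc[of d N u us k x_s] d us len Suc.prems by simp
  qed
  have "u \<in> pc_controls N tf"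
    using us len N unfolding pc_controls_def
    by (auto simp: tf_def u_def intro!: exI[of _ us])
  \<comment> \<open>The index is capped at \<open>N - 1\<close>, so every value of \<open>u\<close>,
    also at the final time, is an entry of \<open>us\<close>.\<close>
  moreover have "u t \<in> U" if "t \<in> {0..tf}" for t
    using that feas N by (auto simp: u_def global_feasible_def)
  moreover have "flow f (real k * d) x_s u \<in> X" if "k < N" for k
    using feas xs[of k] that by (auto simp: global_feasible_def)
  moreover have "flow f tf x_s u \<in> Xf"
    using feas xs[of N] by (auto simp: global_feasible_def tf_def)
  ultimately have "u \<in> admissible_controls f X U Xf N x_s tf"
    using N by (simp add: admissible_controls_def tf_def)
  then have "(tf, u) \<in> ocp_feasible f X U Xf N x_s dmin dmax"
    using d by (simp add: ocp_feasible_def tf_def mult_left_mono)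
  moreover have "identified f N x_s (tf, u) (us, xs, d) (us, xs, replicate N d)"
    using us xs N by (simp add: identified_def tf_def)
  ultimately show ?thesis
    by blast
qed

end

section \<open>Equivalence of the three problems\<close>

theorem proposition2:
  fixes f :: "(real ^ 'p) \<times> (real ^ 'q) \<Rightarrow> real ^ 'p"
    and X Xf :: "(real ^ 'p) set" and U :: "(real ^ 'q) set"
    and x_s :: "real ^ 'p" and N :: nat and dmin dmax :: real
  assumes f_continuous: "continuous_on UNIV f"
    and f_lipschitz: "\<And>v. \<exists>L. L-lipschitz_on UNIV (\<lambda>x. f (x, v))"
    and unique_solution: "\<And>M T x0 u. 0 < M \<Longrightarrow> 0 \<le> T \<Longrightarrow> u \<in> pc_controls M T \<Longrightarrow>
          \<exists>!x. solves f T x0 u x"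
    and "x_s \<in> X" and "0 < N" and "Xf \<subseteq> X" and "0 \<le> dmin" and "dmin \<le> dmax"
  defines "SolA \<equiv> minimizers ocp_cost (ocp_feasible f X U Xf N x_s dmin dmax)"
    and "SolB \<equiv> minimizers (global_cost N) (global_feasible f X U Xf N x_s dmin dmax)"
    and "SolC \<equiv> minimizers (local_cost N) (local_feasible f X U Xf N x_s dmin dmax)"
  shows "(\<forall>a\<in>SolA. \<exists>b\<in>SolB. \<exists>c\<in>SolC. identified f N x_s a b c) \<and>
         (\<forall>b\<in>SolB. \<exists>a\<in>SolA. \<exists>c\<in>SolC. identified f N x_s a b c) \<and>
         (\<forall>c\<in>SolC. \<exists>a\<in>SolA. \<exists>b\<in>SolB. identified f N x_s a b c) \<and>
         optimal_value ocp_cost (ocp_feasible f X U Xf N x_s dmin dmax) =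
           optimal_value (global_cost N) (global_feasible f X U Xf N x_s dmin dmax) \<and>
         optimal_value (global_cost N) (global_feasible f X U Xf N x_s dmin dmax) =
           optimal_value (local_cost N) (local_feasible f X U Xf N x_s dmin dmax)"
proof -
  interpret well_posed_system f
    by unfold_locales (fact unique_solution)
  define F where "F = ocp_feasible f X U Xf N x_s dmin dmax"
  define G where "G = global_feasible f X U Xf N x_s dmin dmax"
  define H where "H = local_feasible f X U Xf N x_s dmin dmax"
  \<comment> \<open>Feasibility is built into \<open>R\<close>, since \<open>identified\<close>
    alone does not imply it: for a zero step, for instance, it does not tie \<open>u\<close> to
    \<open>us\<close>.\<close>
  define R where "R = (\<lambda>a b c. a \<in> F \<and> b \<in> G \<and> c \<in> H \<and> identified f N x_s a b c)"
  have iff: "(us, xs, replicate N d) \<in> H \<longleftrightarrow> (us, xs, d) \<in> G" for us xs d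
    using \<open>0 < N\<close> by (simp add: G_def H_def replicate_in_local_feasible_iff)
  have cost: "global_cost N b = ocp_cost a \<and> local_cost N c = ocp_cost a" if "R a b c" for a b c
  proof -
    obtain tf u us xs d us' xs' dts where abc: "a = (tf, u)" "b = (us, xs, d)" "c = (us', xs', dts)"
      by (metis surj_pair)
    then have "tf = real N * d" and "\<forall>k<N. dts ! k = d"
      using that by (simp_all add: R_def identified_def)
    then show ?thesis
      by (simp add: abc ocp_cost_def global_cost_def local_cost_def)
  qed
  have A: "\<exists>b c. R a b c" if aF: "a \<in> F" for a
  proof -
    obtain tf u where a: "a = (tf, u)"
      by (cases a)
    then obtain us xs d where "(us, xs, d) \<in> G"
      and "identified f N x_s (tf, u) (us, xs, d) (us, xs, replicate N d)"
      using ocp_to_global[of tf u X U Xf N x_s dmin dmax] aF \<open>0 < N\<close> \<open>0 \<le> dmin\<close>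
      unfolding F_def G_def a by blast
    then have "R a (us, xs, d) (us, xs, replicate N d)"
      using a iff aF by (simp only: R_def simp_thms)
    then show ?thesis
      by blast
  qed
  \<comment> \<open>The partner in \<open>H\<close> is given explicitly, so that the same fact also
    serves points of \<open>H\<close>, which all have this form.\<close>
  have B: "\<exists>a. R a (us, xs, d) (us, xs, replicate N d)" if G: "(us, xs, d) \<in> G" for us xs d
  proof -
    obtain tf u where "(tf, u) \<in> F"
      and "identified f N x_s (tf, u) (us, xs, d) (us, xs, replicate N d)"
      using global_to_ocp[of us xs d X U Xf N x_s dmin dmax] G \<open>0 < N\<close> \<open>0 \<le> dmin\<close>
      unfolding F_def G_def by blast
    then have "R (tf, u) (us, xs, d) (us, xs, replicate N d)"
      using iff G by (simp only: R_def simp_thms)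
    then show ?thesis
      by blast
  qed
  have C: "\<exists>a b. R a b c" if "c \<in> H" for c
  proof -
    obtain us xs dts where c: "c = (us, xs, dts)"
      by (cases c)
    then have "c = (us, xs, replicate N (dts ! 0))"
      using local_dts_eq_replicate that unfolding H_def by blast
    then show ?thesis
      using B that iff by metis
  qed
  have "(\<forall>a\<in>SolA. \<exists>b\<in>SolB. \<exists>c\<in>SolC. R a b c) \<and> (\<forall>b\<in>SolB. \<exists>a\<in>SolA. \<exists>c\<in>SolC. R a b c) \<and>
    (\<forall>c\<in>SolC. \<exists>a\<in>SolA. \<exists>b\<in>SolB. R a b c) \<and>
    optimal_value ocp_cost F = optimal_value (global_cost N) G \<and>
    optimal_value (global_cost N) G = optimal_value (local_cost N) H"
    unfolding SolA_def SolB_def SolC_def F_def[symmetric] G_def[symmetric] H_def[symmetric]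
  proof (rule solution_correspondence)
    show "a \<in> F \<and> b \<in> G \<and> c \<in> H \<and> global_cost N b = ocp_cost a \<and> local_cost N c = ocp_cost a"
      if "R a b c" for a b c
      using that cost by (simp add: R_def)
    show "\<exists>a c. R a b c" if "b \<in> G" for b
      using B that by (cases b) blast
  qed (use A C in auto)
  then show ?thesis
    unfolding R_def F_def G_def H_def by blast
qed

end
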